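(* Let $K\ge 2$, $\alpha\in(0,1)$, and let $T=(t_{ij})$ be a $K\times K$ stochastic matrix of the block form $$T=\begin{bmatrix}1 & \mathbf{0}\\ r & Q\end{bmatrix},$$ where $r$ is a $(K-1)\times 1$ column vector with at least one positive entry and $Q$ is an irreducible $(K-1)\times(K-1)$ matrix. Let $f:\mathbb{N}\to[0,1]$ be a deterministic function with $\lim_{n\to\infty}f[n]=0$. Let $(X[n],A[n])_{n\ge 0}$ be the Random Actions process with parameters $\alpha$ and $T$ in which agent $1$ is a drifting agent driven by $f$ (as defined in the context), the initial values $X_2[0],\dots,X_K[0]\in[0,1]$ being arbitrary. Then $X_k[n]\to 0$ in probability for every agent, i.e. for every $\varepsilon>0$, $$\lim_{n\to\infty}\mathbb{P}(X_k[n]>\varepsilon)=0\quad\text{for all }k\in\{1,2,\dots,K\}.$$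
   Context: A stochastic matrix is a square matrix with non-negative entries all of whose row sums equal $1$. Here $\mathbb{N}=\{0,1,2,\dots\}$. Random Actions model with a drifting agent: $X[n]=(X_1[n],\dots,X_K[n])^T\in[0,1]^K$ and $A[n]=(A_1[n],\dots,A_K[n])^T\in\{0,1\}^K$ are random vectors for $n\ge 0$, with $X[0]$ deterministic. At each time $n$, each agent $k$ chooses a random action $A_k[n]\sim\mathrm{Bernoulli}(X_k[n])$, i.e. $\mathbb{P}(A_k[n]=1\mid X[n])=X_k[n]$ and $\mathbb{P}(A_k[n]=0\mid X[n])=1-X_k[n]$. Agent $1$ is the drifting agent: $X_1[n]=f[n]$ for all $n\ge 0$, so $A_1[n]=1$ with probability $f[n]$ and $A_1[n]=0$ with probability $1-f[n]$. The other agents $k=2,\dots,K$ update according to the rule $X[n+1]=(1-\alpha)X[n]+\alpha TA[n]$, i.e. $$X_k[n+1]=(1-\alpha)X_k[n]+\alpha\sum_{j=1}^{K}t_{kj}A_j[n],\qquad k=2,\dots,K.$$ *)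

theory Defs
  imports "HOL-Probability.Probability" "Jordan_Normal_Form.Matrix"
begin

definition stochastic_mat :: "real mat \<Rightarrow> bool" where
  "stochastic_mat T \<longleftrightarrow> square_mat T \<and>
     (\<forall>i<dim_row T. \<forall>j<dim_col T. 0 \<le> T $$ (i, j)) \<and>
     (\<forall>i<dim_row T. (\<Sum>j<dim_col T. T $$ (i, j)) = 1)"

text \<open>Meant for matrices with non-negative entries, where it says that the directed graph of the
  positive entries is strongly connected. The exponent \<open>0\<close> is allowed, so every
  \<open>1 \<times> 1\<close> matrix, including the zero matrix, counts as irreducible.\<close>

definition irreducible_mat :: "real mat \<Rightarrow> bool" where
  "irreducible_mat Q \<longleftrightarrow> square_mat Q \<and>
     (\<forall>i<dim_row Q. \<forall>j<dim_row Q. \<exists>m. 0 < (Q ^\<^sub>m m) $$ (i, j))"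

text \<open>Agents are numbered \<open>0, \<dots>, K - 1\<close>, matching the row and column indices of
  matrices; agent \<open>0\<close> is the drifting agent. \<open>X n k\<close> and \<open>A n k\<close> are the opinion and
  the action of agent \<open>k\<close> at time \<open>n\<close>, and \<open>x0\<close> contains the deterministic initial
  opinions of the other agents. The law of the actions is only prescribed agent by agent,
  conditionally on the current opinion vector; no independence between agents is assumed.\<close>

locale random_actions_drifting = prob_space M
  for M :: "'a measure" +
  fixes K :: nat and \<alpha> :: real and T :: "real mat" and f x0 :: "nat \<Rightarrow> real"
    and X A :: "nat \<Rightarrow> nat \<Rightarrow> 'a \<Rightarrow> real"
  assumes X_measurable: "\<And>n k. k < K \<Longrightarrow> X n k \<in> borel_measurable M"
    and A_measurable: "\<And>n k. k < K \<Longrightarrow> A n k \<in> borel_measurable M"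
    and X_range: "\<And>n k \<omega>. k < K \<Longrightarrow> \<omega> \<in> space M \<Longrightarrow> X n k \<omega> \<in> {0..1}"
    and A_range: "\<And>n k \<omega>. k < K \<Longrightarrow> \<omega> \<in> space M \<Longrightarrow> A n k \<omega> \<in> {0, 1}"
    and X_initial: "\<And>k \<omega>. 1 \<le> k \<Longrightarrow> k < K \<Longrightarrow> \<omega> \<in> space M \<Longrightarrow> X 0 k \<omega> = x0 k"
    and X_drift: "\<And>n \<omega>. \<omega> \<in> space M \<Longrightarrow> X n 0 \<omega> = f n"
    and X_update: "\<And>n k \<omega>. 1 \<le> k \<Longrightarrow> k < K \<Longrightarrow> \<omega> \<in> space M \<Longrightarrow>
      X (Suc n) k \<omega> = (1 - \<alpha>) * X n k \<omega> + \<alpha> * (\<Sum>j<K. T $$ (k, j) * A n j \<omega>)"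
    and A_cond_one: "\<And>n k. k < K \<Longrightarrow> AE \<omega> in M.
      real_cond_exp M
        (vimage_algebra (space M) (\<lambda>\<omega>. \<lambda>i\<in>{..<K}. X n i \<omega>) (\<Pi>\<^sub>M i\<in>{..<K}. borel))
        (indicator {\<omega> \<in> space M. A n k \<omega> = 1}) \<omega> = X n k \<omega>"
    and A_cond_zero: "\<And>n k. k < K \<Longrightarrow> AE \<omega> in M.
      real_cond_exp M
        (vimage_algebra (space M) (\<lambda>\<omega>. \<lambda>i\<in>{..<K}. X n i \<omega>) (\<Pi>\<^sub>M i\<in>{..<K}. borel))
        (indicator {\<omega> \<in> space M. A n k \<omega> = 0}) \<omega> = 1 - X n k \<omega>"

end

theory Submission imports Defs begin

text \<open>Taking expectations turns the update rule into a deterministic linear recursion with forcing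
  \<open>f n\<close>, which tends to \<open>0\<close>. The upper limits of the expected opinions are then subharmonic for
  \<open>Q\<close>, which is irreducible and has a row of sum less than \<open>1\<close>, so the maximum principle forces
  them to be \<open>0\<close>. Markov's inequality transfers this to convergence in probability.\<close>

section \<open>Maximum principle for irreducible substochastic matrices\<close>

text \<open>A positive entry of a matrix power yields a walk along positive entries of
  \<open>Q\<close>, and such a walk cannot leave \<open>S\<close>. Irreducibility provides a walk
  from \<open>i\<close> to every \<open>j\<close>.\<close>

lemma irreducible_mat_closed_set:
  assumes Q: "Q \<in> carrier_mat n n" and irr: "irreducible_mat Q"
    and nonneg: "\<And>i j. i < n \<Longrightarrow> j < n \<Longrightarrow> 0 \<le> Q $$ (i, j)"
    and closed: "\<And>i j. i < n \<Longrightarrow> j < n \<Longrightarrow> i \<in> S \<Longrightarrow> 0 < Q $$ (i, j) \<Longrightarrow> j \<in> S"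
    and "i < n" "i \<in> S" "j < n"
  shows "j \<in> S"
proof -
  have "j \<in> S" if "j < n" "0 < (Q ^\<^sub>m m) $$ (i, j)" for m j
    using that
  proof (induction m arbitrary: j)
    \<comment> \<open>The zeroth power is the identity matrix, so positivity forces
      \<open>j = i\<close>.\<close>
    case 0
    then show ?case
      using Q \<open>i < n\<close> \<open>i \<in> S\<close> by (auto split: if_splits)
  next
    case (Suc m)
    have "Q ^\<^sub>m m \<in> carrier_mat n n"
      using Q by (rule pow_carrier_mat)
    then have "(Q ^\<^sub>m Suc m) $$ (i, j) = (\<Sum>l<n. (Q ^\<^sub>m m) $$ (i, l) * Q $$ (l, j))"
      using Q \<open>i < n\<close> Suc.prems(1) by (simp add: scalar_prod_def atLeast0LessThan)
    then obtain l where l: "l < n" "0 < (Q ^\<^sub>m m) $$ (i, l) * Q $$ (l, j)"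
      using Suc.prems(2) sum_nonpos[of "{..<n}" "\<lambda>l. (Q ^\<^sub>m m) $$ (i, l) * Q $$ (l, j)"]
      by (metis lessThan_iff not_le)
    \<comment> \<open>Since \<open>Q $$ (l, j)\<close> is non-negative, a positive product cannot
      come from two negative factors; the sign of the entries of the power need not be known
      beforehand.\<close>
    then have "0 < (Q ^\<^sub>m m) $$ (i, l)" "0 < Q $$ (l, j)"
      using nonneg[OF l(1) Suc.prems(1)] by (auto simp: zero_less_mult_iff)
    then show ?case
      using Suc.IH[OF l(1)] closed[OF l(1) Suc.prems(1)] by blast
  qed
  then show ?thesis
    using irr Q \<open>i < n\<close> \<open>j < n\<close> unfolding irreducible_mat_def by fastforce
qed

text \<open>If the maximum \<open>m\<close> of \<open>h\<close> were positive, every positive entry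
  in the row of a maximiser would lead to another maximiser. Irreducibility then makes the deficient
  index \<open>d\<close> a maximiser, where the averaging inequality fails because the row sum is
  less than 1.\<close>

lemma subharmonic_nonpos:
  fixes h :: "nat \<Rightarrow> real"
  assumes Q: "Q \<in> carrier_mat n n" and irr: "irreducible_mat Q"
    and nonneg: "\<And>i j. i < n \<Longrightarrow> j < n \<Longrightarrow> 0 \<le> Q $$ (i, j)"
    and row_sum: "\<And>i. i < n \<Longrightarrow> (\<Sum>j<n. Q $$ (i, j)) \<le> 1"
    and deficient: "d < n" "(\<Sum>j<n. Q $$ (d, j)) < 1"
    and sub: "\<And>i. i < n \<Longrightarrow> h i \<le> (\<Sum>j<n. Q $$ (i, j) * h j)"
    and "i < n"
  shows "h i \<le> 0"
proof (rule ccontr)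
  assume "\<not> h i \<le> 0"
  define m where "m = Max (h ` {..<n})"
  have h_le: "h j \<le> m" if "j < n" for j
    using that by (simp add: m_def)
  have "0 < m"
    using h_le[OF \<open>i < n\<close>] \<open>\<not> h i \<le> 0\<close> by simp
  have "m \<in> h ` {..<n}"
    unfolding m_def using \<open>i < n\<close> by (intro Max_in) auto
  then obtain a where a: "a < n" "h a = m"
    by auto
  \<comment> \<open>Subharmonicity at a maximiser, rewritten in terms of the gaps
    \<open>m - h j\<close>. The left side is a sum of non-negative terms, so a right side that is at
    most 0 makes all of them vanish, and a negative one is impossible.\<close>
  have defect: "(\<Sum>j<n. Q $$ (k, j) * (m - h j)) \<le> m * (\<Sum>j<n. Q $$ (k, j)) - m"
    if "k < n" "h k = m" for k
    using sub[OF that(1)] that(2)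
    by (simp add: right_diff_distrib sum_subtractf sum_distrib_left mult.commute[of m])
  have defect_nonneg: "0 \<le> Q $$ (k, j) * (m - h j)" if "k < n" "j < n" for k j
    using nonneg h_le that by simp
  have attained: "h j = m" if "k < n" "j < n" "h k = m" "0 < Q $$ (k, j)" for k j
  proof -
    have "m * (\<Sum>j<n. Q $$ (k, j)) \<le> m * 1"
      using row_sum[OF that(1)] \<open>0 < m\<close> by (intro mult_left_mono) auto
    then have "(\<Sum>j<n. Q $$ (k, j) * (m - h j)) \<le> 0"
      using defect[OF that(1,3)] by simp
    then have "(\<Sum>j<n. Q $$ (k, j) * (m - h j)) = 0"
      using defect_nonneg[OF that(1)] by (intro antisym sum_nonneg) auto
    then have "Q $$ (k, j) * (m - h j) = 0"
      using defect_nonneg[OF that(1)] that(2) by (subst (asm) sum_nonneg_eq_0_iff) auto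
    then show ?thesis
      using that(4) by simp
  qed
  have "d \<in> {k. h k = m}"
  proof (rule irreducible_mat_closed_set[OF Q irr nonneg])
    show "j \<in> {k. h k = m}" if "k < n" "j < n" "k \<in> {k. h k = m}" "0 < Q $$ (k, j)" for k j
      using attained[OF that(1,2) _ that(4)] that(3) by simp
    show "a < n" "a \<in> {k. h k = m}" "d < n"
      using a deficient(1) by simp_all
  qed
  then have "(\<Sum>j<n. Q $$ (d, j) * (m - h j)) \<le> m * (\<Sum>j<n. Q $$ (d, j)) - m"
    using defect[OF deficient(1)] by simp
  moreover have "0 \<le> (\<Sum>j<n. Q $$ (d, j) * (m - h j))"
    using defect_nonneg[OF deficient(1)] by (intro sum_nonneg) simp
  moreover have "m * (\<Sum>j<n. Q $$ (d, j)) < m * 1"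
    using deficient(2) \<open>0 < m\<close> by (intro mult_strict_left_mono)
  ultimately show False
    by simp
qed

section \<open>Upper limits and the forced linear recursion\<close>

text \<open>\<open>L\<close> is the limit superior, taken as the infimum of all eventual upper
  bounds. The bound \<open>b\<close> makes this set non-empty and \<open>a\<close> bounds it from
  below, so everything stays within the reals.\<close>

lemma real_upper_limit_exists:
  fixes u :: "nat \<Rightarrow> real"
  assumes "\<And>n. u n \<in> {a..b}"
  obtains L where "\<And>\<delta>. 0 < \<delta> \<Longrightarrow> \<forall>\<^sub>F n in sequentially. u n \<le> L + \<delta>"
    and "\<And>c. \<forall>\<^sub>F n in sequentially. u n \<le> c \<Longrightarrow> L \<le> c"
proof
  let ?C = "{c. \<forall>\<^sub>F n in sequentially. u n \<le> c}"
  have "a \<le> c" if "c \<in> ?C" for c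
  proof -
    from that obtain n where "u n \<le> c"
      by (auto simp: eventually_sequentially)
    then show ?thesis
      using assms[of n] by simp
  qed
  then have bdd: "bdd_below ?C"
    by (rule bdd_belowI)
  have "b \<in> ?C"
    using assms by simp
  show "Inf ?C \<le> c" if "\<forall>\<^sub>F n in sequentially. u n \<le> c" for c
    using that bdd by (intro cInf_lower) auto
  show "\<forall>\<^sub>F n in sequentially. u n \<le> Inf ?C + \<delta>" if "0 < \<delta>" for \<delta>
  proof -
    have "Inf ?C < Inf ?C + \<delta>"
      using that by simp
    then obtain c where "c \<in> ?C" "c < Inf ?C + \<delta>"
      using \<open>b \<in> ?C\<close> by (metis cInf_lessD empty_iff)
    then show ?thesis
      by (auto elim: eventually_mono)
  qed
qed

text \<open>Taking upper limits in the recursion removes the forcing and leaves a subharmonic vector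
  \<open>L\<close>. The maximum principle gives \<open>L i \<le> 0\<close>, and non-negativity of
  \<open>u\<close> turns this into convergence.\<close>

lemma forced_recursion_tendsto_zero:
  fixes u g :: "nat \<Rightarrow> nat \<Rightarrow> real"
  assumes Q: "Q \<in> carrier_mat n n" and irr: "irreducible_mat Q"
    and nonneg: "\<And>i j. i < n \<Longrightarrow> j < n \<Longrightarrow> 0 \<le> Q $$ (i, j)"
    and row_sum: "\<And>i. i < n \<Longrightarrow> (\<Sum>j<n. Q $$ (i, j)) \<le> 1"
    and deficient: "d < n" "(\<Sum>j<n. Q $$ (d, j)) < 1"
    and \<alpha>: "0 < \<alpha>" "\<alpha> < 1"
    and u_range: "\<And>t i. i < n \<Longrightarrow> u t i \<in> {0..b}"
    and u_Suc: "\<And>t i. i < n \<Longrightarrow>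
      u (Suc t) i = (1 - \<alpha>) * u t i + \<alpha> * (g t i + (\<Sum>j<n. Q $$ (i, j) * u t j))"
    and g: "\<And>i. i < n \<Longrightarrow> (\<lambda>t. g t i) \<longlonglongrightarrow> 0"
    and "i < n"
  shows "(\<lambda>t. u t i) \<longlonglongrightarrow> 0"
proof -
  have "\<exists>L. (\<forall>\<delta>>0. \<forall>\<^sub>F t in sequentially. u t i \<le> L + \<delta>) \<and>
      (\<forall>c. (\<forall>\<^sub>F t in sequentially. u t i \<le> c) \<longrightarrow> L \<le> c)" if "i < n" for i
    using real_upper_limit_exists[of "\<lambda>t. u t i" 0 b] u_range[OF that] by metis
  then obtain L where
    L_upper: "\<And>i \<delta>. i < n \<Longrightarrow> 0 < \<delta> \<Longrightarrow> \<forall>\<^sub>F t in sequentially. u t i \<le> L i + \<delta>" and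
    L_least: "\<And>i c. i < n \<Longrightarrow> \<forall>\<^sub>F t in sequentially. u t i \<le> c \<Longrightarrow> L i \<le> c"
    by metis
  have sub: "L i \<le> (\<Sum>j<n. Q $$ (i, j) * L j)" if "i < n" for i
  proof -
    have "\<alpha> * L i \<le> \<alpha> * (\<Sum>j<n. Q $$ (i, j) * L j) + e" if "0 < e" for e
    proof -
      \<comment> \<open>The errors add up to \<open>(1 - \<alpha>) * \<delta>\<close> from
        \<open>u t i\<close> and \<open>2 * \<alpha> * \<delta>\<close> from the forcing and the
        weighted sum. The total \<open>(1 + \<alpha>) * \<delta>\<close> is at most
        \<open>2 * \<delta> = e\<close>.\<close>
      define \<delta> where "\<delta> = e / 2"
      have "0 < \<delta>"
        using that by (simp add: \<delta>_def)
      have "\<forall>\<^sub>F t in sequentially. \<forall>j\<in>{..<n}. u t j \<le> L j + \<delta>"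
        using L_upper \<open>0 < \<delta>\<close> by (intro eventually_ball_finite) auto
      moreover have "\<forall>\<^sub>F t in sequentially. g t i < \<delta>"
        using g[OF \<open>i < n\<close>] \<open>0 < \<delta>\<close> by (rule order_tendstoD)
      ultimately have "\<forall>\<^sub>F t in sequentially.
        u (Suc t) i \<le> (1 - \<alpha>) * L i + \<alpha> * (\<Sum>j<n. Q $$ (i, j) * L j) + e"
      proof eventually_elim
        case (elim t)
        have "(\<Sum>j<n. Q $$ (i, j) * u t j) \<le> (\<Sum>j<n. Q $$ (i, j) * (L j + \<delta>))"
          using elim(1) nonneg \<open>i < n\<close> by (intro sum_mono mult_left_mono) auto
        also have "\<dots> = (\<Sum>j<n. Q $$ (i, j) * L j) + (\<Sum>j<n. Q $$ (i, j)) * \<delta>"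
          by (simp add: distrib_left sum.distrib sum_distrib_right)
        also have "\<dots> \<le> (\<Sum>j<n. Q $$ (i, j) * L j) + 1 * \<delta>"
          using row_sum[OF \<open>i < n\<close>] \<open>0 < \<delta>\<close> by (intro add_left_mono mult_right_mono) auto
        finally have "g t i + (\<Sum>j<n. Q $$ (i, j) * u t j) \<le> (\<Sum>j<n. Q $$ (i, j) * L j) + 2 * \<delta>"
          using elim(2) by simp
        then have "\<alpha> * (g t i + (\<Sum>j<n. Q $$ (i, j) * u t j))
          \<le> \<alpha> * ((\<Sum>j<n. Q $$ (i, j) * L j) + 2 * \<delta>)"
          using \<alpha> by (intro mult_left_mono) auto
        moreover have "(1 - \<alpha>) * u t i \<le> (1 - \<alpha>) * (L i + \<delta>)"
          using elim(1) \<alpha> \<open>i < n\<close> by (intro mult_left_mono) auto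
        moreover have "\<alpha> * \<delta> \<le> \<delta>"
          using \<alpha> \<open>0 < \<delta>\<close> by simp
        moreover have "e = 2 * \<delta>"
          by (simp add: \<delta>_def)
        ultimately show ?case
          using u_Suc[OF \<open>i < n\<close>, of t] by (simp add: algebra_simps)
      qed
      \<comment> \<open>Eventual bounds are insensitive to the time shift, so the bound on
        \<open>u (Suc t) i\<close> also bounds \<open>u t i\<close> and the minimality of
        \<open>L i\<close> applies.\<close>
      then have "\<forall>\<^sub>F t in sequentially.
        u t i \<le> (1 - \<alpha>) * L i + \<alpha> * (\<Sum>j<n. Q $$ (i, j) * L j) + e"
        using eventually_sequentially_Suc[of "\<lambda>t. u t i \<le> (1 - \<alpha>) * L i +
          \<alpha> * (\<Sum>j<n. Q $$ (i, j) * L j) + e"] by blast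
      then have "L i \<le> (1 - \<alpha>) * L i + \<alpha> * (\<Sum>j<n. Q $$ (i, j) * L j) + e"
        by (rule L_least[OF \<open>i < n\<close>])
      then show ?thesis
        by (simp add: algebra_simps)
    qed
    then have "\<alpha> * L i \<le> \<alpha> * (\<Sum>j<n. Q $$ (i, j) * L j)"
      by (rule field_le_epsilon)
    then show ?thesis
      using \<alpha> by simp
  qed
  have "L i \<le> 0"
    using Q irr nonneg row_sum deficient sub \<open>i < n\<close> by (rule subharmonic_nonpos)
  show ?thesis
  proof (rule order_tendstoI)
    fix a :: real
    assume "a < 0"
    then show "\<forall>\<^sub>F t in sequentially. a < u t i"
      using u_range[OF \<open>i < n\<close>] by (intro always_eventually) (auto intro: less_le_trans)
  next
    fix a :: real
    assume "0 < a"
    then show "\<forall>\<^sub>F t in sequentially. u t i < a"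
      using L_upper[OF \<open>i < n\<close>, of "a / 2"] \<open>L i \<le> 0\<close> by (auto elim!: eventually_mono)
  qed
qed

section \<open>Expected opinions in the model\<close>

context random_actions_drifting
begin

lemma integrable_X:
  assumes "k < K"
  shows "integrable M (X n k)"
proof (rule integrable_const_bound[where B = 1])
  show "AE \<omega> in M. norm (X n k \<omega>) \<le> 1"
    using X_range[OF assms, of _ n] by (intro AE_I2) simp
qed (rule X_measurable[OF assms])

lemma integrable_A:
  assumes "k < K"
  shows "integrable M (A n k)"
proof (rule integrable_const_bound[where B = 1])
  show "AE \<omega> in M. norm (A n k \<omega>) \<le> 1"
    using A_range[OF assms, of _ n] by (intro AE_I2) fastforce
qed (rule A_measurable[OF assms])

lemma expectation_X_range:
  assumes "k < K"
  shows "expectation (X n k) \<in> {0..1}"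
proof -
  have "0 \<le> expectation (X n k)"
    using X_range[OF assms, of _ n] by (intro integral_nonneg_AE AE_I2) simp
  moreover have "expectation (X n k) \<le> 1"
    using X_range[OF assms, of _ n] by (intro integral_le_const integrable_X[OF assms] AE_I2) simp
  ultimately show ?thesis
    by simp
qed

text \<open>Tower property: the mean of a 0/1-valued action is the probability of the value 1, and
  integrating its conditional probability given the opinions returns the mean opinion.\<close>

lemma expectation_A:
  assumes "k < K"
  shows "expectation (A n k) = expectation (X n k)"
proof -
  let ?F = "vimage_algebra (space M) (\<lambda>\<omega>. \<lambda>i\<in>{..<K}. X n i \<omega>) (\<Pi>\<^sub>M i\<in>{..<K}. borel)"
  let ?B = "{\<omega> \<in> space M. A n k \<omega> = 1}"
  \<comment> \<open>Joint measurability of the opinion vector makes the sigma-algebra it generates a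
    subalgebra of \<open>M\<close>, as conditional expectation requires.\<close>
  have "(\<lambda>\<omega>. \<lambda>i\<in>{..<K}. X n i \<omega>) \<in> measurable M (\<Pi>\<^sub>M i\<in>{..<K}. borel)"
    using X_measurable by (intro measurable_restrict) auto
  then have "subalgebra M ?F"
    unfolding subalgebra_def by (simp add: sets_image_in_sets)
  then interpret F: finite_measure_subalgebra M ?F
    by unfold_locales
  have B: "?B \<in> sets M"
    using A_measurable[OF assms, of n] by measurable
  have "expectation (A n k) = expectation (indicator ?B)"
    using A_range[OF assms] by (intro Bochner_Integration.integral_cong) (auto simp: indicator_def)
  also have "\<dots> = expectation (real_cond_exp M ?F (indicator ?B))"
    using B by (intro F.real_cond_exp_int(2)[symmetric]) (simp add: emeasure_eq_measure)
  also have "\<dots> = expectation (X n k)"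
    using A_cond_one[OF assms, of n] X_measurable[OF assms, of n]
    by (intro integral_cong_AE) auto
  finally show ?thesis .
qed

text \<open>The update is linear in the actions, so only their means enter, and
  \<open>expectation_A\<close> replaces these by mean opinions. The means thus satisfy a closed
  recursion.\<close>

lemma expectation_X_Suc:
  assumes "1 \<le> k" "k < K"
  shows "expectation (X (Suc n) k) =
    (1 - \<alpha>) * expectation (X n k) + \<alpha> * (\<Sum>j<K. T $$ (k, j) * expectation (X n j))"
proof -
  have "expectation (X (Suc n) k) =
      expectation (\<lambda>\<omega>. (1 - \<alpha>) * X n k \<omega> + \<alpha> * (\<Sum>j<K. T $$ (k, j) * A n j \<omega>))"
    using X_update[OF assms] by (intro Bochner_Integration.integral_cong) auto
  also have "\<dots> = (1 - \<alpha>) * expectation (X n k) + \<alpha> * (\<Sum>j<K. T $$ (k, j) * expectation (A n j))"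
    using integrable_X[OF assms(2)] integrable_A
    by (subst Bochner_Integration.integral_add) (auto simp: Bochner_Integration.integral_sum)
  finally show ?thesis
    by (simp add: expectation_A)
qed

lemma expectation_X_drift: "expectation (X n 0) = f n"
proof -
  have "expectation (X n 0) = expectation (\<lambda>_. f n)"
    using X_drift by (intro Bochner_Integration.integral_cong) auto
  then show ?thesis
    by (simp add: prob_space)
qed

text \<open>Opinions are non-negative, so Markov's inequality bounds the probability by the mean
  divided by \<epsilon>.\<close>

lemma prob_X_greater_tendsto_zero:
  assumes "k < K" "0 < \<epsilon>" and lim: "(\<lambda>n. expectation (X n k)) \<longlonglongrightarrow> 0"
  shows "(\<lambda>n. prob {\<omega> \<in> space M. X n k \<omega> > \<epsilon>}) \<longlonglongrightarrow> 0"
proof (rule tendsto_sandwich[where f = "\<lambda>_. 0"])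
  have "prob {\<omega> \<in> space M. X n k \<omega> > \<epsilon>} \<le> expectation (X n k) / \<epsilon>" for n
  proof -
    have "prob {\<omega> \<in> space M. X n k \<omega> > \<epsilon>} \<le> prob {\<omega> \<in> space M. X n k \<omega> \<ge> \<epsilon>}"
      using X_measurable[OF assms(1), of n] by (intro finite_measure_mono) auto
    also have "\<dots> \<le> expectation (X n k) / \<epsilon>"
      using integrable_X[OF assms(1)] X_range[OF assms(1)] assms(2)
      by (intro integral_Markov_inequality_measure[where A = "space M"]) auto
    finally show ?thesis .
  qed
  then show "\<forall>\<^sub>F n in sequentially. prob {\<omega> \<in> space M. X n k \<omega> > \<epsilon>} \<le> expectation (X n k) / \<epsilon>"
    by simp
  show "(\<lambda>n. expectation (X n k) / \<epsilon>) \<longlonglongrightarrow> 0"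
    using tendsto_divide[OF lim tendsto_const, of \<epsilon>] assms(2) by simp
qed auto

end

section \<open>Block structure of the weights and conclusion\<close>

theorem proposition3:
  fixes M :: "'a measure" and K :: nat and \<alpha> :: real
    and T r Q :: "real mat" and f x0 :: "nat \<Rightarrow> real"
    and X A :: "nat \<Rightarrow> nat \<Rightarrow> 'a \<Rightarrow> real"
  assumes "2 \<le> K"
    and "0 < \<alpha>" and "\<alpha> < 1"
    and "T \<in> carrier_mat K K" and "stochastic_mat T"
    and "r \<in> carrier_mat (K - 1) 1" and "Q \<in> carrier_mat (K - 1) (K - 1)"
    and "T = four_block_mat (1\<^sub>m 1) (0\<^sub>m 1 (K - 1)) r Q"
    and "\<exists>i<K - 1. 0 < r $$ (i, 0)"
    and "irreducible_mat Q"
    and "\<And>n. f n \<in> {0..1}"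
    and "f \<longlonglongrightarrow> 0"
    and "\<And>k. 1 \<le> k \<Longrightarrow> k < K \<Longrightarrow> x0 k \<in> {0..1}"
    and "random_actions_drifting M K \<alpha> T f x0 X A"
  shows "\<forall>k<K. \<forall>\<epsilon>>0. (\<lambda>n. measure M {\<omega> \<in> space M. X n k \<omega> > \<epsilon>}) \<longlonglongrightarrow> 0"
proof (intro allI impI)
  interpret random_actions_drifting M K \<alpha> T f x0 X A
    by fact
  fix k and \<epsilon> :: real
  assume "k < K" "0 < \<epsilon>"
  \<comment> \<open>\<open>n\<close> is the size of \<open>Q\<close>. Row \<open>i\<close> of
    \<open>Q\<close> and \<open>r\<close> belongs to agent \<open>Suc i\<close>, as index 0 of
    \<open>T\<close> is the drifting agent.\<close>
  define n where "n = K - 1"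
  have K: "K = Suc n"
    using \<open>2 \<le> K\<close> by (simp add: n_def)
  note r = \<open>r \<in> carrier_mat (K - 1) 1\<close>[folded n_def]
  note Q = \<open>Q \<in> carrier_mat (K - 1) (K - 1)\<close>[folded n_def]
  note T = \<open>T = four_block_mat (1\<^sub>m 1) (0\<^sub>m 1 (K - 1)) r Q\<close>[folded n_def]
  have T_entries: "T $$ (Suc i, 0) = r $$ (i, 0)" "T $$ (Suc i, Suc j) = Q $$ (i, j)"
    if "i < n" "j < n" for i j
    using r Q that by (auto simp: T)
  have T_nonneg: "0 \<le> T $$ (i, j)" if "i < K" "j < K" for i j
    using assms(4,5) that by (auto simp: stochastic_mat_def)
  have Q_nonneg: "0 \<le> Q $$ (i, j)" if "i < n" "j < n" for i j
    using T_nonneg[of "Suc i" "Suc j"] T_entries that K by simp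
  have r_nonneg: "0 \<le> r $$ (i, 0)" if "i < n" for i
    using T_nonneg[of "Suc i" 0] T_entries(1)[OF that that] that K by simp
  \<comment> \<open>The column of the drifting agent is split off. The weights \<open>y\<close> stay
    general: constant 1 gives the row sums, the mean opinions give the recursion.\<close>
  have T_row: "(\<Sum>j<K. T $$ (Suc i, j) * y j) = r $$ (i, 0) * y 0 + (\<Sum>j<n. Q $$ (i, j) * y (Suc j))"
    if "i < n" for i and y :: "nat \<Rightarrow> real"
    unfolding K sum.lessThan_Suc_shift using T_entries that by simp
  have row_sum: "r $$ (i, 0) + (\<Sum>j<n. Q $$ (i, j)) = 1" if "i < n" for i
  proof -
    have "(\<Sum>j<K. T $$ (Suc i, j)) = 1"
      using assms(4,5) that K by (auto simp: stochastic_mat_def)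
    then show ?thesis
      using T_row[OF that, of "\<lambda>_. 1"] by simp
  qed
  \<comment> \<open>A positive entry of \<open>r\<close> takes mass away from row \<open>d\<close>
    of \<open>Q\<close>, which makes it the deficient row.\<close>
  obtain d where d: "d < n" "0 < r $$ (d, 0)"
    using assms(9) by (auto simp: n_def)
  have "(\<lambda>t. expectation (X t k)) \<longlonglongrightarrow> 0"
  proof (cases k)
    case 0
    then show ?thesis
      using \<open>f \<longlonglongrightarrow> 0\<close> by (simp add: expectation_X_drift)
  next
    case (Suc i)
    show ?thesis
      unfolding Suc
    \<comment> \<open>The forcing \<open>r $$ (i, 0) * f t\<close> is the mean influence of the
      drifting agent on agent \<open>Suc i\<close>, before the factor \<alpha>.\<close>
    proof (rule forced_recursion_tendsto_zero[OF Q \<open>irreducible_mat Q\<close> Q_nonneg,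
          where u = "\<lambda>t i. expectation (X t (Suc i))" and g = "\<lambda>t i. r $$ (i, 0) * f t"])
      show "(\<Sum>j<n. Q $$ (i, j)) \<le> 1" if "i < n" for i
        using row_sum[OF that] r_nonneg[OF that] by simp
      show "d < n" "(\<Sum>j<n. Q $$ (d, j)) < 1"
        using d row_sum[OF d(1)] by simp_all
      show "0 < \<alpha>" "\<alpha> < 1"
        by fact+
      show "expectation (X t (Suc i)) \<in> {0..1}" if "i < n" for t i
        using that K by (intro expectation_X_range) simp
      show "expectation (X (Suc t) (Suc i)) = (1 - \<alpha>) * expectation (X t (Suc i)) +
          \<alpha> * (r $$ (i, 0) * f t + (\<Sum>j<n. Q $$ (i, j) * expectation (X t (Suc j))))"
        if "i < n" for t i
        using expectation_X_Suc[of "Suc i" t] T_row[OF that, of "\<lambda>j. expectation (X t j)"] that K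
        by (simp add: expectation_X_drift)
      show "(\<lambda>t. r $$ (i, 0) * f t) \<longlonglongrightarrow> 0" for i
        using tendsto_mult_left[OF \<open>f \<longlonglongrightarrow> 0\<close>, of "r $$ (i, 0)"] by simp
      show "i < n"
        using Suc \<open>k < K\<close> K by simp
    qed
  qed
  then show "(\<lambda>n. prob {\<omega> \<in> space M. X n k \<omega> > \<epsilon>}) \<longlonglongrightarrow> 0"
    by (rule prob_X_greater_tendsto_zero[OF \<open>k < K\<close> \<open>0 < \<epsilon>\<close>])
qed

end
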